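(* Let $Q$ be a power-associative CC-loop. Then for every $x\in Q$ the cube $x^3$ is a WIP element.
   Context: A loop is a set $Q$ with a binary operation having a two-sided identity $1$ such that all equations $xu=y$ and $vx=y$ have unique solutions $u=x\backslash y$ and $v=y/x$. A loop $Q$ is conjugacy closed (a CC-loop) if there are functions $f,g:Q\times Q\to Q$ such that for all $x,y,z\in Q$: $x(yz)=f(x,y)(xz)$ and $(zy)x=(zx)g(x,y)$. A loop is power-associative if for each $x$ the subloop $\langle x\rangle$ generated by $x$ is a group. An element $c$ is a WIP element if $c\cdot((yc)\backslash 1)=y\backslash 1$ for all $y\in Q$. *)

theory Defs
  imports "HOL-Algebra.Group"
begin

text \<open>
  Loops are carried by the \<open>monoid\<close> record of HOL-Algebra, which only packages a carrier,
  a binary operation and a unit and does not itself presuppose associativity.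
\<close>

locale loop =
  fixes Q :: "('a, 'b) monoid_scheme" (structure)
  assumes m_closed: "\<lbrakk>x \<in> carrier Q; y \<in> carrier Q\<rbrakk> \<Longrightarrow> x \<otimes> y \<in> carrier Q"
    and one_closed: "\<one> \<in> carrier Q"
    and l_one: "x \<in> carrier Q \<Longrightarrow> \<one> \<otimes> x = x"
    and r_one: "x \<in> carrier Q \<Longrightarrow> x \<otimes> \<one> = x"
    and ex1_ldiv: "\<lbrakk>x \<in> carrier Q; y \<in> carrier Q\<rbrakk> \<Longrightarrow> \<exists>!u. u \<in> carrier Q \<and> x \<otimes> u = y"
    and ex1_rdiv: "\<lbrakk>x \<in> carrier Q; y \<in> carrier Q\<rbrakk> \<Longrightarrow> \<exists>!v. v \<in> carrier Q \<and> v \<otimes> x = y"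

text \<open>\<open>ldiv Q x y\<close> is $x \backslash y$, and \<open>rdiv Q y x\<close> is $y / x$.\<close>

definition ldiv :: "('a, 'b) monoid_scheme \<Rightarrow> 'a \<Rightarrow> 'a \<Rightarrow> 'a" where
  "ldiv Q x y = (THE u. u \<in> carrier Q \<and> x \<otimes>\<^bsub>Q\<^esub> u = y)"

definition rdiv :: "('a, 'b) monoid_scheme \<Rightarrow> 'a \<Rightarrow> 'a \<Rightarrow> 'a" where
  "rdiv Q y x = (THE v. v \<in> carrier Q \<and> v \<otimes>\<^bsub>Q\<^esub> x = y)"

locale cc_loop = loop +
  assumes left_cc:
      "\<exists>f. \<forall>x\<in>carrier Q. \<forall>y\<in>carrier Q. f x y \<in> carrier Q \<and>
        (\<forall>z\<in>carrier Q. x \<otimes> (y \<otimes> z) = f x y \<otimes> (x \<otimes> z))"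
    and right_cc:
      "\<exists>g. \<forall>x\<in>carrier Q. \<forall>y\<in>carrier Q. g x y \<in> carrier Q \<and>
        (\<forall>z\<in>carrier Q. (z \<otimes> y) \<otimes> x = (z \<otimes> x) \<otimes> g x y)"

definition subloop :: "'a set \<Rightarrow> ('a, 'b) monoid_scheme \<Rightarrow> bool" where
  "subloop H Q \<longleftrightarrow> H \<subseteq> carrier Q \<and> \<one>\<^bsub>Q\<^esub> \<in> H \<and>
    (\<forall>x\<in>H. \<forall>y\<in>H. x \<otimes>\<^bsub>Q\<^esub> y \<in> H \<and> ldiv Q x y \<in> H \<and> rdiv Q y x \<in> H)"

definition subloop_generated :: "('a, 'b) monoid_scheme \<Rightarrow> 'a set \<Rightarrow> 'a set" where
  "subloop_generated Q S = \<Inter>{H. subloop H Q \<and> S \<subseteq> H}"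

definition power_associative :: "('a, 'b) monoid_scheme \<Rightarrow> bool" where
  "power_associative Q \<longleftrightarrow>
    (\<forall>x\<in>carrier Q. group (Q\<lparr>carrier := subloop_generated Q {x}\<rparr>))"

definition WIP_element :: "('a, 'b) monoid_scheme \<Rightarrow> 'a \<Rightarrow> bool" where
  "WIP_element Q c \<longleftrightarrow> c \<in> carrier Q \<and>
    (\<forall>y\<in>carrier Q. c \<otimes>\<^bsub>Q\<^esub> ldiv Q (y \<otimes>\<^bsub>Q\<^esub> c) \<one>\<^bsub>Q\<^esub> = ldiv Q y \<one>\<^bsub>Q\<^esub>)"

end

theory Submission
  imports Defs "HOL-Algebra.Bij"
begin

text \<open>
  Let \<open>L\<close> and \<open>R\<close> be the left and right translations by \<open>x\<close>. The two conjugacy laws give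
  \<open>L (z x) = R (L z) R\<^sup>-\<^sup>1 L\<close> and \<open>R (x z) = L (R z) L\<^sup>-\<^sup>1 R\<close>. Since \<open>x\<close> commutes with \<open>x\<^sup>2\<close>, the
  commutator \<open>K = R L R\<^sup>-\<^sup>1 L\<^sup>-\<^sup>1\<close> is central in the group generated by \<open>L\<close> and \<open>R\<close>, and the
  translations by \<open>x\<^sup>2\<close> and \<open>x\<^sup>3\<close> are \<open>K L\<^sup>2\<close>, \<open>K\<^sup>-\<^sup>1 R\<^sup>2\<close>, \<open>K\<^sup>3 L\<^sup>3\<close>, \<open>K\<^sup>-\<^sup>3 R\<^sup>3\<close>.

  Conjugation by the inversion \<open>J\<close> sends \<open>L\<^sup>-\<^sup>1 R\<^sup>2\<close> to \<open>L\<^sup>-\<^sup>2 R\<close>. The same fact for \<open>x\<^sup>2\<close> shows that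
  \<open>J\<close> commutes with \<open>K\<close>. As \<open>J\<close> is an involution, it swaps \<open>L\<^sup>-\<^sup>1 R\<^sup>2\<close> and \<open>L\<^sup>-\<^sup>2 R\<close>, hence inverts
  their commutator \<open>K\<^sup>-\<^sup>3\<close>; so \<open>K\<^sup>6 = 1\<close>. It follows that \<open>J\<close> conjugates \<open>K\<^sup>-\<^sup>3 R\<^sup>3\<close> to the inverse
  of \<open>K\<^sup>3 L\<^sup>3\<close>, which is the weak inverse property of \<open>x\<^sup>3\<close>.
\<close>

section \<open>Groups of nilpotency class two\<close>

text \<open>Conjugation by \<open>g\<close> is an endomorphism of the group, and homomorphisms
  respect integer powers.\<close>

lemma (in group) int_pow_conj:
  assumes "g \<in> carrier G" "x \<in> carrier G"
  shows "(g \<otimes> x \<otimes> inv g) [^] (n::int) = g \<otimes> x [^] n \<otimes> inv g"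
proof -
  have "inv g \<otimes> (g \<otimes> z) = z" if "z \<in> carrier G" for z
    using assms(1) that by (simp flip: m_assoc)
  then have "(\<lambda>x. g \<otimes> x \<otimes> inv g) \<in> hom G G"
    using assms by (auto intro!: homI simp: m_assoc)
  then interpret conj: group_hom G G "\<lambda>x. g \<otimes> x \<otimes> inv g"
    by unfold_locales
  show ?thesis
    using conj.hom_int_pow[OF assms(2), of n] by simp
qed

lemma (in group) int_pow_commute:
  assumes "x \<in> carrier G" "y \<in> carrier G" "x \<otimes> y = y \<otimes> x"
  shows "x [^] (m::int) \<otimes> y = y \<otimes> x [^] m"
proof -
  have "y \<otimes> x \<otimes> inv y = x"
    using assms by (metis inv_solve_right' m_closed)
  then have "y \<otimes> x [^] m \<otimes> inv y = x [^] m"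
    using int_pow_conj[OF assms(2,1), of m] by simp
  then show ?thesis
    using assms by (metis inv_solve_right' int_pow_closed m_closed)
qed

text \<open>Cancel \<open>g \<otimes> g\<close> on the right. Meant for \<open>g\<close> the
  translation by x and \<open>h \<otimes> g \<otimes> g\<close> the translation by x^2: if these
  commute, then so do \<open>h\<close> and \<open>g\<close>.\<close>

lemma (in group) commute_if_square:
  assumes "g \<otimes> (h \<otimes> g \<otimes> g) = h \<otimes> g \<otimes> g \<otimes> g" "g \<in> carrier G" "h \<in> carrier G"
  shows "h \<otimes> g = g \<otimes> h"
proof -
  have "(g \<otimes> h) \<otimes> (g \<otimes> g) = (h \<otimes> g) \<otimes> (g \<otimes> g)"
    using assms by (simp only: m_assoc m_closed)
  then show ?thesis
    using assms by (metis m_closed right_cancel)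
qed

text \<open>Here \<open>k\<close> is the commutator of \<open>b\<close> and \<open>a\<close> and
  commutes with both, so \<open>a\<close> and \<open>b\<close> generate an image of the integral
  Heisenberg group.\<close>

locale class_two_pair = group G for G (structure) +
  fixes a b k
  assumes a_closed [simp]: "a \<in> carrier G"
    and b_closed [simp]: "b \<in> carrier G"
    and k_closed [simp]: "k \<in> carrier G"
    and b_a: "b \<otimes> a = k \<otimes> a \<otimes> b"
    and k_a: "k \<otimes> a = a \<otimes> k"
    and k_b: "k \<otimes> b = b \<otimes> k"
begin

text \<open>Normal form in the subgroup generated by \<open>a\<close> and \<open>b\<close>. The
  exponents need not be unique, since \<open>k\<close> may have finite order.\<close>

definition w :: "int \<Rightarrow> int \<Rightarrow> int \<Rightarrow> 'a" where
  "w p q r = a [^] p \<otimes> b [^] q \<otimes> k [^] r"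

lemma w_closed [simp]: "w p q r \<in> carrier G"
  by (simp add: w_def)

lemma k_pow_a: "k [^] (r::int) \<otimes> a [^] (p::int) = a [^] p \<otimes> k [^] r"
  using int_pow_commute[of a "k [^] r" p] int_pow_commute[of k a r] k_a by simp

lemma k_pow_b: "k [^] (r::int) \<otimes> b [^] (q::int) = b [^] q \<otimes> k [^] r"
  using int_pow_commute[of b "k [^] r" q] int_pow_commute[of k b r] k_b by simp

text \<open>Two conjugations: \<open>b\<close> sends \<open>a\<close> to
  \<open>k \<otimes> a\<close>, which is raised to the power \<open>p\<close>; rearranged,
  \<open>inv (a [^] p)\<close> sends \<open>b\<close> to \<open>k [^] p \<otimes> b\<close>, which
  is raised to the power \<open>q\<close>.\<close>

lemma b_pow_a_pow: "b [^] (q::int) \<otimes> a [^] (p::int) = k [^] (q * p) \<otimes> a [^] p \<otimes> b [^] q"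
proof -
  have "b \<otimes> a \<otimes> inv b = k \<otimes> a"
    by (metis inv_solve_right' b_a m_closed a_closed b_closed k_closed)
  then have "b \<otimes> a [^] p \<otimes> inv b = k [^] p \<otimes> a [^] p"
    using int_pow_conj[of b a p] int_pow_mult_distrib[OF k_a] by simp
  then have "b \<otimes> a [^] p = a [^] p \<otimes> (k [^] p \<otimes> b)"
    by (metis (no_types, lifting) a_closed b_closed int_pow_closed inv_solve_right'
        k_closed k_pow_a m_assoc m_closed)
  then have "inv (a [^] p) \<otimes> b \<otimes> inv (inv (a [^] p)) = k [^] p \<otimes> b"
    by (simp add: m_assoc inv_solve_left')
  moreover have "(k [^] p \<otimes> b) [^] q = k [^] (q * p) \<otimes> b [^] q"
    using int_pow_commute[of k b p] k_b
    by (simp add: int_pow_mult_distrib int_pow_pow k_pow_b mult.commute)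
  ultimately have "inv (a [^] p) \<otimes> b [^] q \<otimes> a [^] p = k [^] (q * p) \<otimes> b [^] q"
    using int_pow_conj[of "inv (a [^] p)" b q] by simp
  then have "b [^] q \<otimes> a [^] p = a [^] p \<otimes> (k [^] (q * p) \<otimes> b [^] q)"
    by (metis (no_types, lifting) a_closed b_closed int_pow_closed inv_closed inv_solve_left
        m_assoc m_closed)
  then show ?thesis
    by (simp add: k_pow_a m_assoc)
qed

text \<open>Moving \<open>b [^] q\<close> past \<open>a [^] p'\<close> creates the term
  \<open>q * p'\<close>; all other moves are free. Products thereby become integer
  arithmetic.\<close>

lemma w_mult: "w p q r \<otimes> w p' q' r' = w (p + p') (q + q') (r + r' + q * p')"
proof -
  let ?A = "\<lambda>n::int. a [^] n" and ?B = "\<lambda>n::int. b [^] n" and ?K = "\<lambda>n::int. k [^] n"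
  have "w p q r \<otimes> w p' q' r' = ?A p \<otimes> ?B q \<otimes> (?K r \<otimes> ?A p') \<otimes> ?B q' \<otimes> ?K r'"
    by (simp add: w_def m_assoc)
  also have "\<dots> = ?A p \<otimes> (?B q \<otimes> ?A p') \<otimes> (?K r \<otimes> ?B q') \<otimes> ?K r'"
    unfolding k_pow_a by (simp add: m_assoc)
  also have "\<dots> = ?A p \<otimes> (?K (q * p') \<otimes> ?A p') \<otimes> ?B q \<otimes> ?B q' \<otimes> ?K r \<otimes> ?K r'"
    unfolding k_pow_b b_pow_a_pow by (simp add: m_assoc)
  also have "\<dots> = ?A p \<otimes> ?A p' \<otimes> (?K (q * p') \<otimes> (?B q \<otimes> ?B q')) \<otimes> ?K r \<otimes> ?K r'"
    unfolding k_pow_a by (simp add: m_assoc)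
  also have "\<dots> = ?A (p + p') \<otimes> ?B (q + q') \<otimes> (?K (q * p') \<otimes> ?K r \<otimes> ?K r')"
    by (simp add: k_pow_b m_assoc flip: int_pow_mult)
  also have "\<dots> = w (p + p') (q + q') (r + r' + q * p')"
    by (simp add: w_def algebra_simps flip: int_pow_mult)
  finally show ?thesis .
qed

lemma w_0: "w 0 0 0 = \<one>"
  by (simp add: w_def)

lemma inv_w: "inv (w p q r) = w (- p) (- q) (- r + p * q)"
  by (rule inv_equality) (simp_all add: w_mult w_0 algebra_simps)

text \<open>With \<open>a\<close> and \<open>b\<close> the translations by x, the conjugation
  hypotheses are \<open>J_conj\<close> for x and for x^2. In the conclusion,
  \<open>w 0 3 (-3)\<close> is the right translation by x^3 and \<open>w (-3) 0 (-3)\<close> the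
  inverse of the left one.\<close>

lemma conj_cube:
  assumes j: "j \<in> carrier G" "j \<otimes> j = \<one>"
    and "j \<otimes> w (-1) 2 0 \<otimes> j = w (-2) 1 0"
    and "j \<otimes> w (-2) 4 (-3) \<otimes> j = w (-4) 2 (-3)"
  shows "j \<otimes> w 0 3 (-3) \<otimes> j = w (-3) 0 (-3)"
proof -
  define \<phi> where "\<phi> x = j \<otimes> x \<otimes> j" for x
  have jj: "j \<otimes> (j \<otimes> z) = z" if "z \<in> carrier G" for z
    using j that by (simp flip: m_assoc)
  have hom: "\<phi> (x \<otimes> y) = \<phi> x \<otimes> \<phi> y" if "x \<in> carrier G" "y \<in> carrier G" for x y
    using that j by (simp add: \<phi>_def m_assoc jj)
  have invol: "\<phi> (\<phi> x) = x" if "x \<in> carrier G" for x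
    using that j by (simp add: \<phi>_def m_assoc jj)
  have \<phi>w: "\<phi> (w p q r \<otimes> w p' q' r') = \<phi> (w p q r) \<otimes> \<phi> (w p' q' r')" for p q r p' q' r'
    by (simp add: hom)
  have \<phi>_closed: "\<phi> (w p q r) \<in> carrier G" for p q r
    using j by (simp add: \<phi>_def)
  have A: "\<phi> (w (-1) 2 0) = w (-2) 1 0"
    and A2: "\<phi> (w (-2) 4 (-3)) = w (-4) 2 (-3)"
    using assms by (simp_all add: \<phi>_def)
  have B: "\<phi> (w (-2) 1 0) = w (-1) 2 0"
    using invol[of "w (-1) 2 0"] A by simp
  have AA: "\<phi> (w (-2) 4 (-2)) = w (-4) 2 (-2)"
    using \<phi>w[of "-1" 2 0 "-1" 2 0] by (simp add: A w_mult)
  have cancel: "y = inv x \<otimes> z" if "x \<otimes> y = z" "x \<in> carrier G" "y \<in> carrier G" for x y z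
    using that by (metis inv_solve_left m_closed)
  \<comment> \<open>\<open>A2\<close> differs from \<open>AA\<close>, the square of
    \<open>A\<close>, by the same factor k^(-1) in argument and value.\<close>
  have K: "\<phi> (w 0 0 (-1)) = w 0 0 (-1)"
    using cancel[OF \<phi>w[of "-2" 4 "-2" 0 0 "-1", symmetric]]
    by (simp add: AA A2 w_mult inv_w \<phi>_closed)
  have K2: "\<phi> (w 0 0 (-2)) = w 0 0 (-2)"
    using \<phi>w[of 0 0 "-1" 0 0 "-1"] by (simp add: K w_mult)
  have K3: "\<phi> (w 0 0 (-3)) = w 0 0 (-3)"
    using \<phi>w[of 0 0 "-1" 0 0 "-2"] by (simp add: K K2 w_mult)
  \<comment> \<open>The exponents -4 and -1 come from multiplying the two swapped elements in either
    order, so \<open>\<phi>\<close> multiplies this product by k^3.\<close>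
  have AB: "\<phi> (w (-3) 3 (-4)) = w (-3) 3 (-1)"
    using \<phi>w[of "-1" 2 0 "-2" 1 0] by (simp add: A B w_mult)
  have BA: "\<phi> (w (-3) 3 (-1)) = w (-3) 3 (-4)"
    using invol[of "w (-3) 3 (-4)"] AB by simp
  \<comment> \<open>The arguments in \<open>AB\<close> and \<open>BA\<close> differ by k^(-3), which
    \<open>\<phi>\<close> fixes; comparing the values gives k^6 = 1.\<close>
  have "w (-3) 3 (-1) = w (-3) 3 (-7)"
    using \<phi>w[of "-3" 3 "-1" 0 0 "-3"] by (simp add: AB BA K3 w_mult)
  then have "inv (w (-3) 3 (-1)) \<otimes> w (-3) 3 (-7) = \<one>"
    by (metis l_inv w_closed)
  then have k6: "w 0 0 (-6) = \<one>"
    by (simp add: inv_w w_mult)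
  \<comment> \<open>The exponent -9 is that of \<open>w 0 3 (-3) \<otimes> w (-2) 1 0\<close>. Now
    \<open>\<phi>\<close> is known on this product and on its second factor, hence on the
    first.\<close>
  have "w (-2) 4 (-9) = w (-2) 4 (-3) \<otimes> w 0 0 (-6)"
    by (simp add: w_mult)
  then have "\<phi> (w (-2) 4 (-9)) = w (-4) 2 (-3)"
    by (simp add: k6 A2)
  then have "\<phi> (w 0 3 (-3)) \<otimes> w (-1) 2 0 = w (-4) 2 (-3)"
    using \<phi>w[of 0 3 "-3" "-2" 1 0] by (simp add: B w_mult)
  then have "\<phi> (w 0 3 (-3)) = w (-4) 2 (-3) \<otimes> inv (w (-1) 2 0)"
    by (metis \<phi>_closed inv_solve_right w_closed)
  then have "\<phi> (w 0 3 (-3)) = w (-3) 0 (-3)"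
    by (simp add: inv_w w_mult)
  then show ?thesis
    by (simp add: \<phi>_def)
qed

end

section \<open>Translations of conjugacy closed loops\<close>

context loop
begin

abbreviation B :: "('a \<Rightarrow> 'a) monoid" where
  "B \<equiv> BijGroup (carrier Q)"

text \<open>Restricted to the carrier because \<open>BijGroup\<close> consists of extensional
  bijections.\<close>

definition L :: "'a \<Rightarrow> 'a \<Rightarrow> 'a" where
  "L x = (\<lambda>y\<in>carrier Q. x \<otimes> y)"

definition R :: "'a \<Rightarrow> 'a \<Rightarrow> 'a" where
  "R x = (\<lambda>y\<in>carrier Q. y \<otimes> x)"

text \<open>Right inversion. The weak inverse property of c says that \<open>R c\<close>, then
  \<open>J\<close>, then \<open>L c\<close> compose to \<open>J\<close>.\<close>

definition J :: "'a \<Rightarrow> 'a" where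
  "J = (\<lambda>y\<in>carrier Q. ldiv Q y \<one>)"

interpretation bij: group B
  by (rule group_BijGroup)

declare m_closed [simp] one_closed [simp] l_one [simp] r_one [simp]

lemma l_cancel:
  "\<lbrakk>x \<otimes> y = x \<otimes> z; x \<in> carrier Q; y \<in> carrier Q; z \<in> carrier Q\<rbrakk> \<Longrightarrow> y = z"
  using ex1_ldiv[of x "x \<otimes> z"] by auto

lemma r_cancel:
  "\<lbrakk>y \<otimes> x = z \<otimes> x; x \<in> carrier Q; y \<in> carrier Q; z \<in> carrier Q\<rbrakk> \<Longrightarrow> y = z"
  using ex1_rdiv[of x "z \<otimes> x"] by auto

lemma ldiv_works:
  assumes "x \<in> carrier Q" "y \<in> carrier Q"
  shows ldiv_closed: "ldiv Q x y \<in> carrier Q" and mult_ldiv: "x \<otimes> ldiv Q x y = y"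
  using theI'[OF ex1_ldiv[OF assms]] by (simp_all add: ldiv_def)

lemma ldiv_unique:
  assumes "x \<otimes> u = y" "x \<in> carrier Q" "u \<in> carrier Q"
  shows "ldiv Q x y = u"
  using assms l_cancel ldiv_closed mult_ldiv m_closed by metis

lemma rdiv_works:
  assumes "x \<in> carrier Q" "y \<in> carrier Q"
  shows rdiv_closed: "rdiv Q y x \<in> carrier Q" and rdiv_mult: "rdiv Q y x \<otimes> x = y"
  using theI'[OF ex1_rdiv[OF assms]] by (simp_all add: rdiv_def)

lemma rdiv_unique:
  assumes "u \<otimes> x = y" "x \<in> carrier Q" "u \<in> carrier Q"
  shows "rdiv Q y x = u"
  using assms r_cancel rdiv_closed rdiv_mult m_closed by metis

lemma L_apply [simp]: "y \<in> carrier Q \<Longrightarrow> L x y = x \<otimes> y"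
  by (simp add: L_def)

lemma R_apply [simp]: "y \<in> carrier Q \<Longrightarrow> R x y = y \<otimes> x"
  by (simp add: R_def)

lemma J_apply: "y \<in> carrier Q \<Longrightarrow> J y = ldiv Q y \<one>"
  by (simp add: J_def)

lemma J_closed [simp]: "y \<in> carrier Q \<Longrightarrow> J y \<in> carrier Q"
  by (simp add: J_apply ldiv_closed)

lemma mult_J [simp]: "y \<in> carrier Q \<Longrightarrow> y \<otimes> J y = \<one>"
  by (simp add: J_apply mult_ldiv)

lemma bij_eqI:
  assumes "f \<in> carrier B" "g \<in> carrier B" "\<And>y. y \<in> carrier Q \<Longrightarrow> f y = g y"
  shows "f = g"
  using assms by (auto simp: BijGroup_def Bij_def intro: extensionalityI)

lemma bij_mult_apply [simp]:
  "\<lbrakk>f \<in> carrier B; g \<in> carrier B; y \<in> carrier Q\<rbrakk> \<Longrightarrow> (f \<otimes>\<^bsub>B\<^esub> g) y = f (g y)"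
  by (simp add: BijGroup_def compose_def)

lemma bij_apply_closed [simp]:
  "\<lbrakk>f \<in> carrier B; y \<in> carrier Q\<rbrakk> \<Longrightarrow> f y \<in> carrier Q"
  by (auto simp: BijGroup_def dest: Bij_imp_funcset)

lemma bij_memI:
  assumes "f \<in> extensional (carrier Q)"
    and "\<And>y. y \<in> carrier Q \<Longrightarrow> f y \<in> carrier Q" "\<And>y. y \<in> carrier Q \<Longrightarrow> g y \<in> carrier Q"
    and "\<And>y. y \<in> carrier Q \<Longrightarrow> g (f y) = y" "\<And>y. y \<in> carrier Q \<Longrightarrow> f (g y) = y"
  shows "f \<in> carrier B"
proof -
  have "bij_betw f (carrier Q) (carrier Q)"
    by (rule bij_betw_byWitness[where f' = g]) (use assms in auto)
  then show ?thesis
    using assms(1) by (simp add: BijGroup_def Bij_def)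
qed

lemma L_in_bij [simp]:
  assumes "x \<in> carrier Q"
  shows "L x \<in> carrier B"
proof (rule bij_memI[where g = "ldiv Q x"])
  show "L x \<in> extensional (carrier Q)"
    by (simp add: L_def)
qed (simp_all add: assms ldiv_closed mult_ldiv ldiv_unique)

lemma R_in_bij [simp]:
  assumes "x \<in> carrier Q"
  shows "R x \<in> carrier B"
proof (rule bij_memI[where g = "\<lambda>y. rdiv Q y x"])
  show "R x \<in> extensional (carrier Q)"
    by (simp add: R_def)
qed (simp_all add: assms rdiv_closed rdiv_mult rdiv_unique)

end

section \<open>The conjugacy laws as identities between translations\<close>

context cc_loop
begin

interpretation bij: group B
  by (rule group_BijGroup)

text \<open>Taking the unit for \<open>z\<close> in the right conjugacy law identifies its witness
  at \<open>y\<close> as the value at \<open>y\<close> of \<open>R x\<close> followed by the inverse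
  of \<open>L x\<close>.\<close>

lemma R_mult_L:
  assumes "x \<in> carrier Q" "z \<in> carrier Q"
  shows "R x \<otimes>\<^bsub>B\<^esub> L z = L (z \<otimes> x) \<otimes>\<^bsub>B\<^esub> (inv\<^bsub>B\<^esub> L x \<otimes>\<^bsub>B\<^esub> R x)"
    (is "?l = ?r")
proof (rule bij_eqI)
  fix y assume y: "y \<in> carrier Q"
  obtain g where g: "g \<in> carrier Q" and eq: "\<And>z. z \<in> carrier Q \<Longrightarrow> (z \<otimes> y) \<otimes> x = (z \<otimes> x) \<otimes> g"
    using right_cc assms(1) y by blast
  define D where "D = inv\<^bsub>B\<^esub> L x \<otimes>\<^bsub>B\<^esub> R x"
  have D: "D \<in> carrier B"
    using assms by (simp add: D_def)
  have "L x \<otimes>\<^bsub>B\<^esub> D = R x"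
    using assms by (simp add: D_def flip: bij.m_assoc)
  then have "x \<otimes> D y = y \<otimes> x"
    using assms y D bij_mult_apply[of "L x" D y] by simp
  also have "\<dots> = x \<otimes> g"
    using eq[of \<one>] assms y by simp
  finally have "D y = g"
    using l_cancel assms y g D by simp
  then show "?l y = ?r y"
    using assms y g D eq[of z] by (simp flip: D_def)
qed (use assms in simp_all)

lemma L_mult_R:
  assumes "x \<in> carrier Q" "z \<in> carrier Q"
  shows "L x \<otimes>\<^bsub>B\<^esub> R z = R (x \<otimes> z) \<otimes>\<^bsub>B\<^esub> (inv\<^bsub>B\<^esub> R x \<otimes>\<^bsub>B\<^esub> L x)"
    (is "?l = ?r")
proof (rule bij_eqI)
  fix y assume y: "y \<in> carrier Q"
  obtain f where f: "f \<in> carrier Q" and eq: "\<And>z. z \<in> carrier Q \<Longrightarrow> x \<otimes> (y \<otimes> z) = f \<otimes> (x \<otimes> z)"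
    using left_cc assms(1) y by blast
  define E where "E = inv\<^bsub>B\<^esub> R x \<otimes>\<^bsub>B\<^esub> L x"
  have E: "E \<in> carrier B"
    using assms by (simp add: E_def)
  have "R x \<otimes>\<^bsub>B\<^esub> E = L x"
    using assms by (simp add: E_def flip: bij.m_assoc)
  then have "E y \<otimes> x = x \<otimes> y"
    using assms y E bij_mult_apply[of "R x" E y] by simp
  also have "\<dots> = f \<otimes> x"
    using eq[of \<one>] assms y by simp
  finally have "E y = f"
    using r_cancel assms y f E by simp
  then show "?l y = ?r y"
    using assms y f E eq[of z] by (simp flip: E_def)
qed (use assms in simp_all)

text \<open>At the unit the left law gives
  \<open>f \<otimes> x = x \<otimes> y = y \<otimes> x\<close>, so the witness is \<open>y\<close>
  itself.\<close>

lemma L_commute: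
  assumes x: "x \<in> carrier Q" and y: "y \<in> carrier Q" and xy: "x \<otimes> y = y \<otimes> x"
  shows "L x \<otimes>\<^bsub>B\<^esub> L y = L y \<otimes>\<^bsub>B\<^esub> L x"
proof (rule bij_eqI)
  fix z assume z: "z \<in> carrier Q"
  obtain f where f: "f \<in> carrier Q" and eq: "\<And>z. z \<in> carrier Q \<Longrightarrow> x \<otimes> (y \<otimes> z) = f \<otimes> (x \<otimes> z)"
    using left_cc x y by blast
  have "f \<otimes> x = y \<otimes> x"
    using eq[of \<one>] x y xy by simp
  then have "f = y"
    using x f y by (rule r_cancel)
  then show "(L x \<otimes>\<^bsub>B\<^esub> L y) z = (L y \<otimes>\<^bsub>B\<^esub> L x) z"
    using eq[OF z] x y z by simp
qed (use x y in simp_all)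

lemma R_commute:
  assumes x: "x \<in> carrier Q" and y: "y \<in> carrier Q" and xy: "x \<otimes> y = y \<otimes> x"
  shows "R x \<otimes>\<^bsub>B\<^esub> R y = R y \<otimes>\<^bsub>B\<^esub> R x"
proof (rule bij_eqI)
  fix z assume z: "z \<in> carrier Q"
  obtain g where g: "g \<in> carrier Q" and eq: "\<And>z. z \<in> carrier Q \<Longrightarrow> (z \<otimes> y) \<otimes> x = (z \<otimes> x) \<otimes> g"
    using right_cc x y by blast
  have "x \<otimes> g = x \<otimes> y"
    using eq[of \<one>] x y xy by simp
  then have "g = y"
    using x g y by (rule l_cancel)
  then show "(R x \<otimes>\<^bsub>B\<^esub> R y) z = (R y \<otimes>\<^bsub>B\<^esub> R x) z"
    using eq[OF z] x y z by simp
qed (use x y in simp_all)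

text \<open>Solve \<open>R_mult_L\<close> for the translation by the product, whose cofactor has
  inverse \<open>inv R x\<close> times \<open>L x\<close>. Iteration reaches the powers of
  x.\<close>

lemma L_mult:
  assumes "x \<in> carrier Q" "z \<in> carrier Q"
  shows "L (z \<otimes> x) = R x \<otimes>\<^bsub>B\<^esub> L z \<otimes>\<^bsub>B\<^esub> inv\<^bsub>B\<^esub> R x \<otimes>\<^bsub>B\<^esub> L x"
proof -
  have "R x \<otimes>\<^bsub>B\<^esub> L z \<otimes>\<^bsub>B\<^esub> (inv\<^bsub>B\<^esub> R x \<otimes>\<^bsub>B\<^esub> L x)
      = L (z \<otimes> x) \<otimes>\<^bsub>B\<^esub> ((inv\<^bsub>B\<^esub> L x \<otimes>\<^bsub>B\<^esub> R x) \<otimes>\<^bsub>B\<^esub> inv\<^bsub>B\<^esub> (inv\<^bsub>B\<^esub> L x \<otimes>\<^bsub>B\<^esub> R x))"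
    unfolding R_mult_L[OF assms] using assms by (simp add: bij.m_assoc bij.inv_mult_group)
  also have "\<dots> = L (z \<otimes> x)"
    using assms by (simp only: bij.r_inv bij.r_one bij.m_closed bij.inv_closed L_in_bij R_in_bij m_closed)
  finally show ?thesis
    using assms by (simp add: bij.m_assoc)
qed

lemma R_mult:
  assumes "x \<in> carrier Q" "z \<in> carrier Q"
  shows "R (x \<otimes> z) = L x \<otimes>\<^bsub>B\<^esub> R z \<otimes>\<^bsub>B\<^esub> inv\<^bsub>B\<^esub> L x \<otimes>\<^bsub>B\<^esub> R x"
proof -
  have "L x \<otimes>\<^bsub>B\<^esub> R z \<otimes>\<^bsub>B\<^esub> (inv\<^bsub>B\<^esub> L x \<otimes>\<^bsub>B\<^esub> R x)
      = R (x \<otimes> z) \<otimes>\<^bsub>B\<^esub> ((inv\<^bsub>B\<^esub> R x \<otimes>\<^bsub>B\<^esub> L x) \<otimes>\<^bsub>B\<^esub> inv\<^bsub>B\<^esub> (inv\<^bsub>B\<^esub> R x \<otimes>\<^bsub>B\<^esub> L x))"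
    unfolding L_mult_R[OF assms] using assms by (simp add: bij.m_assoc bij.inv_mult_group)
  also have "\<dots> = R (x \<otimes> z)"
    using assms by (simp only: bij.r_inv bij.r_one bij.m_closed bij.inv_closed L_in_bij R_in_bij m_closed)
  finally show ?thesis
    using assms by (simp add: bij.m_assoc)
qed

section \<open>Inversion as a permutation\<close>

lemma J_J:
  assumes "\<And>y. y \<in> carrier Q \<Longrightarrow> J y \<otimes> y = \<one>" "y \<in> carrier Q"
  shows "J (J y) = y"
  using assms by (simp add: J_apply[of "J y"] ldiv_unique)

lemma J_in_bij:
  assumes "\<And>y. y \<in> carrier Q \<Longrightarrow> J y \<otimes> y = \<one>"
  shows "J \<in> carrier B"
proof (rule bij_memI[where g = J])
  show "J \<in> extensional (carrier Q)"
    by (simp add: J_def)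
qed (simp_all add: J_J[OF assms])

lemma J_mult_J:
  assumes "\<And>y. y \<in> carrier Q \<Longrightarrow> J y \<otimes> y = \<one>"
  shows "J \<otimes>\<^bsub>B\<^esub> J = \<one>\<^bsub>B\<^esub>"
proof (rule bij_eqI)
  show "(J \<otimes>\<^bsub>B\<^esub> J) y = \<one>\<^bsub>B\<^esub> y" if "y \<in> carrier Q" for y
    using that J_in_bij[OF assms] J_J[OF assms] by (simp add: BijGroup_def compose_def)
qed (use J_in_bij[OF assms] in simp_all)

text \<open>Evaluate \<open>R_mult_L\<close> and \<open>L_mult_R\<close> at pairs of mutual
  inverses: both give \<open>c\<close> as a product with left factor \<open>y \<otimes> c\<close>,
  which cancels.\<close>

lemma J_conj:
  assumes J_inv: "\<And>y. y \<in> carrier Q \<Longrightarrow> J y \<otimes> y = \<one>" and c: "c \<in> carrier Q"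
  shows "J \<otimes>\<^bsub>B\<^esub> (inv\<^bsub>B\<^esub> L c \<otimes>\<^bsub>B\<^esub> (R c \<otimes>\<^bsub>B\<^esub> R c)) \<otimes>\<^bsub>B\<^esub> J
      = inv\<^bsub>B\<^esub> L c \<otimes>\<^bsub>B\<^esub> inv\<^bsub>B\<^esub> L c \<otimes>\<^bsub>B\<^esub> R c"
proof -
  note J = J_in_bij[OF J_inv]
  define D where "D = inv\<^bsub>B\<^esub> L c \<otimes>\<^bsub>B\<^esub> R c"
  have D: "D \<in> carrier B"
    using c by (simp add: D_def)
  have "L c \<otimes>\<^bsub>B\<^esub> (J \<otimes>\<^bsub>B\<^esub> (D \<otimes>\<^bsub>B\<^esub> R c)) = D \<otimes>\<^bsub>B\<^esub> J"
  proof (rule bij_eqI)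
    fix y assume y: "y \<in> carrier Q"
    have "R c \<otimes>\<^bsub>B\<^esub> L y = L (y \<otimes> c) \<otimes>\<^bsub>B\<^esub> D"
      using R_mult_L[OF c y] by (simp add: D_def)
    then have 1: "(y \<otimes> c) \<otimes> D (J y) = c"
      using bij_mult_apply[of "R c" "L y" "J y"] bij_mult_apply[of "L (y \<otimes> c)" D "J y"] c y D
      by simp
    \<comment> \<open>Chosen so that \<open>E u = y \<otimes> c\<close>, as \<open>E\<close> is the
      inverse of \<open>D\<close>.\<close>
    define u where "u = D (y \<otimes> c)"
    have u: "u \<in> carrier Q"
      using c y D by (simp add: u_def)
    define E where "E = inv\<^bsub>B\<^esub> R c \<otimes>\<^bsub>B\<^esub> L c"
    have E: "E \<in> carrier B"
      using c by (simp add: E_def)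
    have "E = inv\<^bsub>B\<^esub> D"
      using c by (simp add: E_def D_def bij.inv_mult_group)
    then have "E \<otimes>\<^bsub>B\<^esub> D = \<one>\<^bsub>B\<^esub>"
      using D by simp
    then have "E u = y \<otimes> c"
      using bij_mult_apply[OF E D, of "y \<otimes> c"] c y by (simp add: u_def BijGroup_def)
    moreover have "E u \<otimes> (c \<otimes> J u) = c"
    proof -
      have "L c \<otimes>\<^bsub>B\<^esub> R (J u) = R (c \<otimes> J u) \<otimes>\<^bsub>B\<^esub> E"
        using L_mult_R[of c "J u"] c u by (simp add: E_def)
      then show ?thesis
        using bij_mult_apply[of "L c" "R (J u)" u] bij_mult_apply[of "R (c \<otimes> J u)" E u] c u E
        by simp
    qed
    ultimately have "(y \<otimes> c) \<otimes> (c \<otimes> J u) = (y \<otimes> c) \<otimes> D (J y)"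
      using 1 by simp
    then have "c \<otimes> J u = D (J y)"
      using l_cancel c y u D by simp
    then show "(L c \<otimes>\<^bsub>B\<^esub> (J \<otimes>\<^bsub>B\<^esub> (D \<otimes>\<^bsub>B\<^esub> R c))) y = (D \<otimes>\<^bsub>B\<^esub> J) y"
      using c y D J by (simp add: u_def)
  qed (use c D J in simp_all)
  then have "J \<otimes>\<^bsub>B\<^esub> (D \<otimes>\<^bsub>B\<^esub> R c) = inv\<^bsub>B\<^esub> L c \<otimes>\<^bsub>B\<^esub> (D \<otimes>\<^bsub>B\<^esub> J)"
    using c D J by (simp add: bij.inv_solve_left)
  then have "J \<otimes>\<^bsub>B\<^esub> (D \<otimes>\<^bsub>B\<^esub> R c) \<otimes>\<^bsub>B\<^esub> J = inv\<^bsub>B\<^esub> L c \<otimes>\<^bsub>B\<^esub> D"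
    using c D J J_mult_J[OF J_inv] by (simp add: bij.m_assoc)
  then show ?thesis
    using c by (simp add: D_def bij.m_assoc)
qed

text \<open>Power-associativity enters through two consequences: two-sided inverses and
  \<open>xx\<close>.\<close>

lemma WIP_element_cube:
  assumes J_inv: "\<And>y. y \<in> carrier Q \<Longrightarrow> J y \<otimes> y = \<one>"
    and x: "x \<in> carrier Q" and xx: "x \<otimes> (x \<otimes> x) = (x \<otimes> x) \<otimes> x"
  shows "WIP_element Q (x \<otimes> (x \<otimes> x))"
proof -
  note J = J_in_bij[OF J_inv]
  define a where "a = L x"
  define b where "b = R x"
  define k where "k = b \<otimes>\<^bsub>B\<^esub> a \<otimes>\<^bsub>B\<^esub> inv\<^bsub>B\<^esub> b \<otimes>\<^bsub>B\<^esub> inv\<^bsub>B\<^esub> a"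
  have ab: "a \<in> carrier B" "b \<in> carrier B"
    using x by (simp_all add: a_def b_def)
  then have k: "k \<in> carrier B"
    by (simp add: k_def)
  have cancel: "g \<otimes>\<^bsub>B\<^esub> (inv\<^bsub>B\<^esub> g \<otimes>\<^bsub>B\<^esub> h) = h" "inv\<^bsub>B\<^esub> g \<otimes>\<^bsub>B\<^esub> (g \<otimes>\<^bsub>B\<^esub> h) = h"
    if "g \<in> carrier B" "h \<in> carrier B" for g h
    using that by (simp_all flip: bij.m_assoc)
  have L2: "L (x \<otimes> x) = k \<otimes>\<^bsub>B\<^esub> a \<otimes>\<^bsub>B\<^esub> a"
    using L_mult[OF x x] ab by (simp add: k_def bij.m_assoc cancel flip: a_def b_def)
  have R2: "R (x \<otimes> x) = inv\<^bsub>B\<^esub> k \<otimes>\<^bsub>B\<^esub> b \<otimes>\<^bsub>B\<^esub> b"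
    using R_mult[OF x x] ab
    by (simp add: k_def bij.m_assoc bij.inv_mult_group cancel flip: a_def b_def)
  have "a \<otimes>\<^bsub>B\<^esub> L (x \<otimes> x) = L (x \<otimes> x) \<otimes>\<^bsub>B\<^esub> a"
    using L_commute[OF x _ xx] x by (simp add: a_def)
  then have ka: "k \<otimes>\<^bsub>B\<^esub> a = a \<otimes>\<^bsub>B\<^esub> k"
    unfolding L2 using ab(1) k by (rule bij.commute_if_square)
  have "b \<otimes>\<^bsub>B\<^esub> R (x \<otimes> x) = R (x \<otimes> x) \<otimes>\<^bsub>B\<^esub> b"
    using R_commute[OF x _ xx] x by (simp add: b_def)
  then have "inv\<^bsub>B\<^esub> k \<otimes>\<^bsub>B\<^esub> b = b \<otimes>\<^bsub>B\<^esub> inv\<^bsub>B\<^esub> k"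
    unfolding R2 using ab(2) bij.inv_closed[OF k] by (rule bij.commute_if_square)
  then have kb: "k \<otimes>\<^bsub>B\<^esub> b = b \<otimes>\<^bsub>B\<^esub> k"
    using bij.int_pow_commute[of "inv\<^bsub>B\<^esub> k" b "-1"] ab k by (simp add: bij.int_pow_neg)
  have "b \<otimes>\<^bsub>B\<^esub> a = k \<otimes>\<^bsub>B\<^esub> a \<otimes>\<^bsub>B\<^esub> b"
    using ab by (simp add: k_def bij.m_assoc cancel)
  then interpret pair: class_two_pair B a b k
    using ab k ka kb by unfold_locales
  have wa: "L x = pair.w 1 0 0" and wb: "R x = pair.w 0 1 0"
    by (simp_all add: pair.w_def flip: a_def b_def)
  have wL2: "L (x \<otimes> x) = pair.w 2 0 1"
    using L_mult[OF x x] by (simp add: wa wb pair.w_mult pair.inv_w)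
  have wR2: "R (x \<otimes> x) = pair.w 0 2 (-1)"
    using R_mult[OF x x] by (simp add: wa wb pair.w_mult pair.inv_w)
  let ?c = "x \<otimes> (x \<otimes> x)"
  have c: "?c \<in> carrier Q"
    using x by simp
  \<comment> \<open>\<open>L_mult\<close> yields the translation by
    \<open>(x \<otimes> x) \<otimes> x\<close>, so \<open>xx\<close> is needed to reach
    \<open>?c\<close>.\<close>
  have wL3: "L ?c = pair.w 3 0 3"
    using L_mult[of x "x \<otimes> x"] x by (simp add: xx wL2 wa wb pair.w_mult pair.inv_w)
  have wR3: "R ?c = pair.w 0 3 (-3)"
    using R_mult[of x "x \<otimes> x"] x by (simp add: wR2 wa wb pair.w_mult pair.inv_w)
  have "J \<otimes>\<^bsub>B\<^esub> R ?c \<otimes>\<^bsub>B\<^esub> J = inv\<^bsub>B\<^esub> L ?c"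
    using pair.conj_cube[OF J J_mult_J[OF J_inv]] J_conj[OF J_inv x] J_conj[OF J_inv, of "x \<otimes> x"] x
    by (simp add: wL3 wR3 wL2 wR2 wa wb pair.w_mult pair.inv_w)
  then have "L ?c \<otimes>\<^bsub>B\<^esub> (J \<otimes>\<^bsub>B\<^esub> R ?c \<otimes>\<^bsub>B\<^esub> J) \<otimes>\<^bsub>B\<^esub> J = J"
    using c J by simp
  then have "L ?c \<otimes>\<^bsub>B\<^esub> (J \<otimes>\<^bsub>B\<^esub> R ?c) = J"
    using c J J_mult_J[OF J_inv] by (simp add: bij.m_assoc del: m_closed)
  then have "?c \<otimes> J (y \<otimes> ?c) = J y" if "y \<in> carrier Q" for y
    using that c J bij_mult_apply[of "L ?c" "J \<otimes>\<^bsub>B\<^esub> R ?c" y] by simp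
  then show ?thesis
    using c by (simp add: WIP_element_def J_apply)
qed

end

section \<open>Power-associative loops\<close>

lemma (in loop) subloop_generated_subset:
  assumes "x \<in> carrier Q"
  shows "subloop_generated Q {x} \<subseteq> carrier Q"
proof -
  have "subloop (carrier Q) Q"
    by (simp add: subloop_def ldiv_closed rdiv_closed)
  then show ?thesis
    using assms by (auto simp: subloop_generated_def)
qed

theorem theorem7p4:
  fixes Q :: "('a, 'b) monoid_scheme" (structure)
  assumes "cc_loop Q" and "power_associative Q"
  shows "\<forall>x\<in>carrier Q. WIP_element Q (x [^] (3::nat))"
proof
  fix x assume x: "x \<in> carrier Q"
  interpret cc_loop Q
    by fact
  have group: "group (Q\<lparr>carrier := subloop_generated Q {y}\<rparr>)" if "y \<in> carrier Q" for y
    using assms(2) that by (simp add: power_associative_def)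
  have gen: "y \<in> subloop_generated Q {y}" for y
    by (simp add: subloop_generated_def)
  \<comment> \<open>The inverse of \<open>y\<close> in the group it generates is two-sided, and
    unique left division identifies it with \<open>J y\<close>.\<close>
  have J_inv: "J y \<otimes> y = \<one>" if y: "y \<in> carrier Q" for y
  proof -
    interpret G: group "Q\<lparr>carrier := subloop_generated Q {y}\<rparr>"
      by (rule group[OF y])
    obtain z where z: "z \<in> subloop_generated Q {y}" "z \<otimes> y = \<one>" "y \<otimes> z = \<one>"
      using G.Units gen[of y] by (auto simp: Units_def)
    then have "z \<in> carrier Q"
      using subloop_generated_subset[OF y] by auto
    then have "J y = z"
      using y z ldiv_unique[of y z \<one>] by (simp add: J_apply)
    then show ?thesis
      using z by simp
  qed
  interpret G: group "Q\<lparr>carrier := subloop_generated Q {x}\<rparr>"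
    by (rule group[OF x])
  have xx: "x \<otimes> (x \<otimes> x) = (x \<otimes> x) \<otimes> x"
    using G.m_assoc[of x x x] gen[of x] by simp
  \<comment> \<open>\<open>nat_pow\<close> multiplies on the right, giving
    \<open>(x \<otimes> x) \<otimes> x\<close>.\<close>
  have "x [^] (3::nat) = x \<otimes> (x \<otimes> x)"
    using x by (simp add: xx numeral_3_eq_3 nat_pow_def)
  then show "WIP_element Q (x [^] (3::nat))"
    using WIP_element_cube[OF J_inv x xx] by simp
qed

end
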